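(* Let $r\ge 3$ and let $\lambda=\alpha_1+\alpha_2+\cdots+\alpha_r$ be the weight of $\mathfrak{sp}_{2r}(\mathbb C)$ given by the sum of the simple roots. Then $|\mathcal A(\lambda,0)|=2L_{r-2}$, where $L_k$ denotes the $k$-th Lucas number.
   Context: Let $\varepsilon_1,\ldots,\varepsilon_r$ be the standard basis of $\mathbb R^r$. The simple roots of $\mathfrak{sp}_{2r}(\mathbb C)$ are $\alpha_i=\varepsilon_i-\varepsilon_{i+1}$ for $1\le i\le r-1$ and $\alpha_r=2\varepsilon_r$; the positive roots are $\Phi^+=\{\varepsilon_i\pm\varepsilon_j:1\le i<j\le r\}\cup\{2\varepsilon_i:1\le i\le r\}$. Set $\rho=\frac12\sum_{\alpha\in\Phi^+}\alpha$. The Weyl group $W$ is generated by the simple reflections $s_i$ in the hyperplanes orthogonal to $\alpha_i$, $1\le i\le r$. Kostant's partition function $\wp(\xi)$ is the number of ways to write $\xi$ as a nonnegative integral linear combination of positive roots (so $\wp(0)=1$). For integral weights $\lambda,\mu$ (not necessarily dominant), the Weyl alternation set is $\mathcal A(\lambda,\mu)=\{\sigma\in W:\wp(\sigma(\lambda+\rho)-(\mu+\rho))>0\}$. Lucas numbers: $L_1=1$, $L_2=3$, $L_n=L_{n-1}+L_{n-2}$. *)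

theory Defs
  imports Complex_Main "HOL-Library.Function_Algebras" "HOL-Library.FuncSet"
    "HOL-Algebra.Bij" "HOL-Algebra.Generated_Groups"
begin

text \<open>
  The rank \<open>r\<close> is a natural number, so \<open>\<real>\<^sup>r\<close> is the space of functions
  \<^typ>\<open>nat \<Rightarrow> real\<close> that vanish outside the index set \<open>{1..r}\<close>. Vectors are added
  and subtracted pointwise.
\<close>

definition euclid :: "nat \<Rightarrow> (nat \<Rightarrow> real) set" where
  "euclid r = {v. \<forall>j. j \<notin> {1..r} \<longrightarrow> v j = 0}"

definition vscale :: "real \<Rightarrow> (nat \<Rightarrow> real) \<Rightarrow> (nat \<Rightarrow> real)" where
  "vscale c v = (\<lambda>j. c * v j)"

definition eps :: "nat \<Rightarrow> (nat \<Rightarrow> real)" where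
  "eps i = (\<lambda>j. if j = i then 1 else 0)"

definition ip :: "nat \<Rightarrow> (nat \<Rightarrow> real) \<Rightarrow> (nat \<Rightarrow> real) \<Rightarrow> real" where
  "ip r u v = (\<Sum>j=1..r. u j * v j)"

definition simple_root :: "nat \<Rightarrow> nat \<Rightarrow> (nat \<Rightarrow> real)" where
  "simple_root r i = (if i < r then eps i - eps (i + 1) else vscale 2 (eps r))"

definition pos_roots :: "nat \<Rightarrow> (nat \<Rightarrow> real) set" where
  "pos_roots r =
     {eps i - eps j | i j. 1 \<le> i \<and> i < j \<and> j \<le> r} \<union>
     {eps i + eps j | i j. 1 \<le> i \<and> i < j \<and> j \<le> r} \<union>
     {vscale 2 (eps i) | i. 1 \<le> i \<and> i \<le> r}"

definition weyl_rho :: "nat \<Rightarrow> (nat \<Rightarrow> real)" where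
  "weyl_rho r = vscale (1/2) (\<Sum>\<alpha>\<in>pos_roots r. \<alpha>)"

definition reflection :: "nat \<Rightarrow> (nat \<Rightarrow> real) \<Rightarrow> (nat \<Rightarrow> real) \<Rightarrow> (nat \<Rightarrow> real)" where
  "reflection r a v = v - vscale (2 * ip r v a / ip r a a) a"

text \<open>
  The Weyl group is a subgroup of the group of bijections of \<^term>\<open>euclid r\<close>. Elements of
  \<^const>\<open>BijGroup\<close> are extensional functions, hence the \<^const>\<open>restrict\<close>.
\<close>

definition weyl_group :: "nat \<Rightarrow> ((nat \<Rightarrow> real) \<Rightarrow> (nat \<Rightarrow> real)) set" where
  "weyl_group r =
     generate (BijGroup (euclid r))
       ((\<lambda>i. restrict (reflection r (simple_root r i)) (euclid r)) ` {1..r})"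

text \<open>
  A way to write \<open>\<xi>\<close> as a combination of positive roots is a family \<open>m\<close> of multiplicities.
  Every \<open>\<xi>\<close> has only finitely many of them, because the positive roots lie in an open
  half-space, so \<^const>\<open>card\<close> gives the true count.
\<close>

definition kostant_partition :: "nat \<Rightarrow> (nat \<Rightarrow> real) \<Rightarrow> nat" where
  "kostant_partition r \<xi> =
     card {m \<in> pos_roots r \<rightarrow>\<^sub>E (UNIV :: nat set).
             (\<Sum>\<alpha>\<in>pos_roots r. vscale (real (m \<alpha>)) \<alpha>) = \<xi>}"

definition alternation_set ::
    "nat \<Rightarrow> (nat \<Rightarrow> real) \<Rightarrow> (nat \<Rightarrow> real) \<Rightarrow> ((nat \<Rightarrow> real) \<Rightarrow> (nat \<Rightarrow> real)) set" where
  "alternation_set r \<nu> \<mu> =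
     {\<sigma> \<in> weyl_group r.
        kostant_partition r (\<sigma> (\<nu> + weyl_rho r) - (\<mu> + weyl_rho r)) > 0}"

text \<open>The usual extension \<open>L\<^sub>0 = 2\<close> gives \<open>L\<^sub>2 = 3\<close>.\<close>

fun lucas :: "nat \<Rightarrow> nat" where
  "lucas 0 = 2"
| "lucas (Suc 0) = 1"
| "lucas (Suc (Suc n)) = lucas (Suc n) + lucas n"

end

theory Submission
  imports Defs "HOL-Combinatorics.Multiset_Permutations"
begin

text \<open>
  With \<open>\<lambda> = \<epsilon>\<^sub>1 + \<epsilon>\<^sub>r\<close> and \<open>\<rho> = (r, r - 1, \<dots>, 1)\<close> the shifted weight is
  \<open>\<lambda> + \<rho> = (r + 1, r - 1, r - 2, \<dots>, 3, 2, 2)\<close>. Its last two coordinates coincide, and this is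
  where the factor \<open>2\<close> comes from.

  A vector is a nonnegative integral combination of positive roots iff it is one of simple roots, and
  its simple root coefficients are its prefix sums (the last one halved). So
  \<open>\<wp>(\<sigma>(\<lambda> + \<rho>) - \<rho>) > 0\<close> asks that the prefix sums of the integral vector
  \<open>\<sigma>(\<lambda> + \<rho>)\<close> dominate those of \<open>\<rho>\<close> and that the two total sums differ by an even number
  (\<open>kostant_partition_pos_imp_prefix_sum_nonneg\<close>, \<open>kostant_partition_posI\<close>).

  The Weyl group acts by signed permutations of the coordinates. The coordinates of
  \<open>\<lambda> + \<rho>\<close> exceed those of \<open>\<rho>\<close> by only \<open>2\<close> in total, while a sign change costs at least
  \<open>4\<close>; hence only unsigned permutations contribute, and for these the difference of the totals
  is exactly \<open>2\<close>. The question has become how many arrangements of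
  \<open>r + 1, r - 1, \<dots>, 3, 2, 2'\<close> (with the two entries \<open>2\<close> told apart) have prefix sums
  dominating those of \<open>r, r - 1, \<dots>, 1\<close> (\<open>kostant_partition_pos_iff_arrangement\<close>).

  The first entry has to be \<open>r + 1\<close>, which leaves a slack of exactly \<open>1\<close>. From then on, among
  remaining entries with maximum \<open>m\<close>, either \<open>m\<close> comes next and the slack stays \<open>1\<close>, or
  \<open>m - 1\<close> comes next, uses the slack up, and forces \<open>m\<close> after it, which restores the slack.
  This is the recurrence \<open>a\<^sub>m = a\<^bsub>m-1\<^esub> + a\<^bsub>m-2\<^esub>\<close> of the Lucas numbers for \<open>m \<ge> 4\<close>
  (\<open>tail_arrangements_step\<close>). Below that the repeated \<open>2\<close> keeps every arrangement admissible, so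
  \<open>a\<^sub>2 = 2!\<close> and \<open>a\<^sub>3 = 3!\<close>, which are twice \<open>L\<^sub>1\<close> and \<open>L\<^sub>2\<close>.
\<close>

section \<open>Arrangements with bounded slack\<close>

text \<open>
  The entries of the list are placed one after the other against the reference sequence
  \<open>m, m - 1, \<dots>\<close>. The number \<open>d\<close> is the slack, the amount by which the prefix sum of the weights
  \<open>w\<close> so far exceeds that of the reference sequence. The recursion makes the effect of the next
  entry explicit, which is what the counting needs; the form with prefix sums follows below.
\<close>

fun slack_ok :: "(nat \<Rightarrow> int) \<Rightarrow> int \<Rightarrow> int \<Rightarrow> nat list \<Rightarrow> bool" where
  "slack_ok w d m [] \<longleftrightarrow> 0 \<le> d"
| "slack_ok w d m (x # xs) \<longleftrightarrow> 0 \<le> d \<and> slack_ok w (d + w x - m) (m - 1) xs"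

lemma slack_ok_nonneg: "slack_ok w d m xs \<Longrightarrow> 0 \<le> d"
  by (cases xs) auto

lemma slack_ok_cong:
  "(\<And>x. x \<in> set xs \<Longrightarrow> w x = w' x) \<Longrightarrow> slack_ok w d m xs \<longleftrightarrow> slack_ok w' d m xs"
  by (induction xs arbitrary: d m) auto

lemma slack_ok_iff_prefix_sums:
  "slack_ok w d m xs \<longleftrightarrow> (\<forall>k\<le>length xs. 0 \<le> d + (\<Sum>i<k. w (xs ! i) - (m - int i)))"
proof (induction xs arbitrary: d m)
  case Nil
  then show ?case by simp
next
  case (Cons x xs)
  have shift: "d + (\<Sum>i<Suc k. w ((x # xs) ! i) - (m - int i))
      = (d + w x - m) + (\<Sum>i<k. w (xs ! i) - ((m - 1) - int i))" for k
    by (simp add: sum.lessThan_Suc_shift algebra_simps del: sum.lessThan_Suc)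
  have split: "(\<forall>k\<le>Suc n. P k) \<longleftrightarrow> P 0 \<and> (\<forall>k\<le>n. P (Suc k))" for P :: "nat \<Rightarrow> bool" and n
    by (metis Suc_le_mono le0 not0_implies_Suc)
  show ?case
    unfolding slack_ok.simps Cons.IH length_Cons split shift by simp
qed

text \<open>
  The labels \<open>1\<close> and \<open>2\<close> both carry the weight \<open>2\<close>: they are the two equal coordinates of the
  shifted weight, kept apart because different Weyl group elements are to be counted separately. The
  initial slack \<open>1\<close> is what remains after the entry \<open>r + 1\<close> has been placed.
\<close>
definition tail_arrangements :: "nat \<Rightarrow> nat list set" where
  "tail_arrangements m =
     {xs \<in> permutations_of_set {1..m}. slack_ok (\<lambda>x. max (int x) 2) 1 (int m) xs}"

lemma permutations_of_set_Cons_iff: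
  "x # xs \<in> permutations_of_set A \<longleftrightarrow> x \<in> A \<and> xs \<in> permutations_of_set (A - {x})"
  by (auto simp: permutations_of_set_def)

lemma finite_tail_arrangements: "finite (tail_arrangements m)"
  by (simp add: tail_arrangements_def)

text \<open>
  With slack \<open>1\<close> the first entry has weight at least \<open>m - 1\<close>. If it is \<open>m - 1\<close>, no slack is
  left, so the next weight must be at least the next reference value, again \<open>m - 1\<close>; only \<open>m\<close> is left for
  that. The bound \<open>m \<ge> 4\<close> matters here: for \<open>m = 3\<close> the label \<open>m - 1 = 2\<close> shares its weight
  with the label \<open>1\<close>.
\<close>
lemma tail_arrangements_step:
  assumes "m \<ge> 4"
  shows "tail_arrangements m =
    Cons m ` tail_arrangements (m - 1) \<union>
    (\<lambda>xs. (m - 1) # m # xs) ` tail_arrangements (m - 2)"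
proof -
  let ?w = "\<lambda>x. max (int x) 2"
  have remove_top: "{1..m} - {m} = {1..m - 1}"
    and remove_two: "{1..m} - {m - 1} - {m} = {1..m - 2}"
    using assms by auto
  have weights: "?w m = int m" "?w (m - 1) = int m - 1"
    "int (m - 1) = int m - 1" "int (m - 2) = int m - 2" "max (int m - 1) 2 = int m - 1"
    using assms by auto
  have top_first: "m # xs \<in> tail_arrangements m \<longleftrightarrow> xs \<in> tail_arrangements (m - 1)" for xs
    using assms unfolding tail_arrangements_def mem_Collect_eq permutations_of_set_Cons_iff
      slack_ok.simps weights remove_top by simp
  have swapped_first:
    "(m - 1) # m # xs \<in> tail_arrangements m \<longleftrightarrow> xs \<in> tail_arrangements (m - 2)" for xs
    using assms unfolding tail_arrangements_def mem_Collect_eq permutations_of_set_Cons_iff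
      slack_ok.simps weights remove_two by (auto simp: algebra_simps)
  have "zs \<in> Cons m ` tail_arrangements (m - 1) \<union>
      (\<lambda>xs. (m - 1) # m # xs) ` tail_arrangements (m - 2)"
    if zs: "zs \<in> tail_arrangements m" for zs
  proof -
    have "zs \<noteq> []"
      using zs assms by (auto simp: tail_arrangements_def permutations_of_set_def)
    then obtain x xs where x: "zs = x # xs" by (cases zs) auto
    have px: "x \<in> {1..m}" "xs \<in> permutations_of_set ({1..m} - {x})"
      and ok: "slack_ok ?w (1 + ?w x - int m) (int m - 1) xs"
      using zs by (simp_all add: tail_arrangements_def x permutations_of_set_Cons_iff)
    have "x = m \<or> x = m - 1"
      using slack_ok_nonneg[OF ok] px(1) assms by (auto simp: max_def split: if_splits)
    then show ?thesis
    proof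
      assume "x = m"
      then show ?thesis using zs top_first x by blast
    next
      assume xm: "x = m - 1"
      have "set xs = {1..m} - {m - 1}"
        using px(2) xm by (simp add: permutations_of_set_def)
      then have "m \<in> set xs" using assms by simp
      then obtain y ys where y: "xs = y # ys" by (cases xs) auto
      have py: "y \<in> {1..m}" "y \<noteq> m - 1"
        using px(2) by (simp_all add: y xm permutations_of_set_Cons_iff)
      have "slack_ok ?w (?w y - (int m - 1)) (int m - 2) ys"
        using ok unfolding xm weights y slack_ok.simps by simp
      then have "y = m"
        using slack_ok_nonneg py assms by (fastforce simp: max_def split: if_splits)
      then show ?thesis using zs swapped_first x xm y by blast
    qed
  qed
  then show ?thesis
    using top_first swapped_first by blast
qed

lemma card_tail_arrangements_step:
  assumes "m \<ge> 4"
  shows "card (tail_arrangements m) =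
    card (tail_arrangements (m - 1)) + card (tail_arrangements (m - 2))"
proof -
  have "card (tail_arrangements m) = card (Cons m ` tail_arrangements (m - 1)) +
      card ((\<lambda>xs. (m - 1) # m # xs) ` tail_arrangements (m - 2))"
    unfolding tail_arrangements_step[OF assms]
    by (rule card_Un_disjoint) (use assms in \<open>auto simp: finite_tail_arrangements\<close>)
  then show ?thesis
    by (simp add: card_image inj_on_def)
qed

lemma tail_arrangements_small:
  assumes "m = 2 \<or> m = 3"
  shows "tail_arrangements m = permutations_of_set {1..m}"
proof -
  have "slack_ok (\<lambda>x. max (int x) 2) 1 (int m) xs" if "xs \<in> permutations_of_set {1..m}" for xs
  proof -
    have "length xs = m" using that by (simp add: length_finite_permutations_of_set)
    then obtain x y zs where xs: "xs = x # y # zs" "length zs = m - 2"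
      using assms by (cases xs; cases "tl xs") auto
    show ?thesis
    proof (cases zs)
      case Nil then show ?thesis using assms xs by auto
    next
      case (Cons z us)
      then have [simp]: "m = 3" "us = []" using assms xs by auto
      have "{x, y, z} = {1..3}"
        using that by (auto simp: xs Cons permutations_of_set_def)
      then have "3 \<in> {x, y, z}" by auto
      then show ?thesis by (auto simp: xs Cons max_def)
    qed
  qed
  then show ?thesis by (auto simp: tail_arrangements_def)
qed

lemma card_tail_arrangements:
  "card (tail_arrangements (n + 2)) = 2 * lucas (n + 1)"
proof (induction n rule: lucas.induct)
  case 1
  then show ?case by (simp add: tail_arrangements_small fact_numeral)
next
  case 2
  then show ?case by (simp add: tail_arrangements_small fact_numeral)
next
  case (3 n)
  then show ?case
    by (simp add: card_tail_arrangements_step numeral_eq_Suc)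
qed


section \<open>Positive roots and the vector rho\<close>
definition root_pairs :: "nat \<Rightarrow> (nat \<times> nat) set" where
  "root_pairs r = {(i, j). 1 \<le> i \<and> i < j \<and> j \<le> r}"

lemma finite_root_pairs: "finite (root_pairs r)"
  by (rule finite_subset[of _ "{1..r} \<times> {1..r}"]) (auto simp: root_pairs_def)

lemma pos_roots_images:
  "pos_roots r = (\<lambda>(i, j). eps i - eps j) ` root_pairs r \<union>
     (\<lambda>(i, j). eps i + eps j) ` root_pairs r \<union> (\<lambda>i. vscale 2 (eps i)) ` {1..r}"
  by (auto simp: pos_roots_def root_pairs_def image_iff)

lemma finite_pos_roots: "finite (pos_roots r)"
  by (simp add: pos_roots_images finite_root_pairs)

lemma sum_fun_apply: "(\<Sum>x\<in>A. f x) k = (\<Sum>x\<in>A. f x k)" for f :: "'a \<Rightarrow> 'b \<Rightarrow> 'c::comm_monoid_add"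
  by (induction A rule: infinite_finite_induct) auto

lemma inj_on_difference_roots: "inj_on (\<lambda>(i, j). eps i - eps j) (root_pairs r)"
proof (rule inj_onI, clarify)
  fix i j i' j' assume ij: "(i, j) \<in> root_pairs r" "(i', j') \<in> root_pairs r"
    and eq: "eps i - eps j = eps i' - eps j'"
  show "i = i' \<and> j = j'"
    using fun_cong[OF eq, of i] fun_cong[OF eq, of j] ij
    by (auto simp: eps_def root_pairs_def split: if_splits)
qed

lemma inj_on_sum_roots: "inj_on (\<lambda>(i, j). eps i + eps j) (root_pairs r)"
proof (rule inj_onI, clarify)
  fix i j i' j' assume ij: "(i, j) \<in> root_pairs r" "(i', j') \<in> root_pairs r"
    and eq: "eps i + eps j = eps i' + eps j'"
  show "i = i' \<and> j = j'"
    using fun_cong[OF eq, of i] fun_cong[OF eq, of j] ij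
    by (auto simp: eps_def root_pairs_def split: if_splits)
qed

lemma inj_long_roots: "inj (\<lambda>i. vscale 2 (eps i))"
proof (rule injI)
  fix i j assume eq: "vscale 2 (eps i) = vscale 2 (eps j)"
  show "i = j"
    using fun_cong[OF eq, of i] by (simp add: vscale_def eps_def split: if_splits)
qed

text \<open>
  The positive roots are given as a set of vectors, so a sum over them becomes a sum over indices only
  once the three families are known to be disjoint. The differences have a negative coordinate, and
  the long roots are the ones with a coordinate \<open>2\<close>.
\<close>
lemma sum_over_pos_roots:
  fixes f :: "(nat \<Rightarrow> real) \<Rightarrow> 'a::comm_monoid_add"
  shows "(\<Sum>\<alpha>\<in>pos_roots r. f \<alpha>) = (\<Sum>(i, j)\<in>root_pairs r. f (eps i - eps j)) +
    (\<Sum>(i, j)\<in>root_pairs r. f (eps i + eps j)) + (\<Sum>i\<in>{1..r}. f (vscale 2 (eps i)))"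
proof -
  let ?D = "(\<lambda>(i, j). eps i - eps j) ` root_pairs r"
  let ?S = "(\<lambda>(i, j). eps i + eps j) ` root_pairs r"
  let ?L = "(\<lambda>i. vscale 2 (eps i)) ` {1..r}"
  have negative: "\<exists>k. \<alpha> k < 0" if "\<alpha> \<in> ?D" for \<alpha>
  proof -
    from that obtain i j where "i < j" "\<alpha> = eps i - eps j" by (auto simp: root_pairs_def)
    then have "\<alpha> j < 0" by (simp add: eps_def)
    then show ?thesis ..
  qed
  have nonnegative: "0 \<le> \<alpha> k" if "\<alpha> \<in> ?S \<union> ?L" for \<alpha> k
    using that by (auto simp: eps_def vscale_def)
  have at_most_one: "\<alpha> k \<le> 1" if "\<alpha> \<in> ?D \<union> ?S" for \<alpha> k
    using that by (auto simp: root_pairs_def eps_def)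
  have two: "\<exists>k. \<alpha> k = 2" if "\<alpha> \<in> ?L" for \<alpha>
  proof -
    from that obtain i where "\<alpha> = vscale 2 (eps i)" by auto
    then have "\<alpha> i = 2" by (simp add: eps_def vscale_def)
    then show ?thesis ..
  qed
  have False if D: "\<alpha> \<in> ?D" and S: "\<alpha> \<in> ?S" for \<alpha>
  proof -
    obtain k where "\<alpha> k < 0" using negative[OF D] ..
    then show False using nonnegative[of \<alpha> k] S by simp
  qed
  moreover have False if DS: "\<alpha> \<in> ?D \<union> ?S" and L: "\<alpha> \<in> ?L" for \<alpha>
  proof -
    obtain k where "\<alpha> k = 2" using two[OF L] ..
    then show False using at_most_one[OF DS, of k] by simp
  qed
  ultimately have disjoint: "?D \<inter> ?S = {}" "(?D \<union> ?S) \<inter> ?L = {}"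
    by blast+
  have "(\<Sum>\<alpha>\<in>pos_roots r. f \<alpha>) = sum f ((?D \<union> ?S) \<union> ?L)"
    by (simp only: pos_roots_images)
  also have "\<dots> = sum f (?D \<union> ?S) + sum f ?L"
    by (rule sum.union_disjoint[OF _ _ disjoint(2)]) (simp_all add: finite_root_pairs)
  also have "sum f (?D \<union> ?S) = sum f ?D + sum f ?S"
    by (rule sum.union_disjoint[OF _ _ disjoint(1)]) (simp_all add: finite_root_pairs)
  also have "sum f ?D = (\<Sum>(i, j)\<in>root_pairs r. f (eps i - eps j))"
    unfolding sum.reindex[OF inj_on_difference_roots] by (rule sum.cong) auto
  also have "sum f ?S = (\<Sum>(i, j)\<in>root_pairs r. f (eps i + eps j))"
    unfolding sum.reindex[OF inj_on_sum_roots] by (rule sum.cong) auto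
  also have "sum f ?L = (\<Sum>i\<in>{1..r}. f (vscale 2 (eps i)))"
    unfolding sum.reindex[OF inj_on_subset[OF inj_long_roots subset_UNIV]] by (rule sum.cong) auto
  finally show ?thesis .
qed

text \<open>
  The roots \<open>\<epsilon>\<^sub>i - \<epsilon>\<^sub>j\<close> and \<open>\<epsilon>\<^sub>i + \<epsilon>\<^sub>j\<close> add up to \<open>2\<epsilon>\<^sub>i\<close>, so \<open>\<epsilon>\<^sub>k\<close> enters
  \<open>\<rho>\<close> once for each \<open>j > k\<close> and once more through the long root.
\<close>
lemma weyl_rho_apply: "weyl_rho r k = (if k \<in> {1..r} then real (r + 1 - k) else 0)"
proof -
  have "(\<Sum>\<alpha>\<in>pos_roots r. \<alpha>) k
      = (\<Sum>(i, j)\<in>root_pairs r. 2 * eps i k) + (\<Sum>i\<in>{1..r}. 2 * eps i k)"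
    unfolding sum_fun_apply sum_over_pos_roots
    by (simp add: vscale_def case_prod_unfold flip: sum.distrib)
  also have "(\<Sum>(i, j)\<in>root_pairs r. 2 * eps i k)
      = (\<Sum>(i, j)\<in>Sigma {1..r} (\<lambda>i. {i<..r}). 2 * eps i k)"
    by (rule sum.cong) (auto simp: root_pairs_def)
  also have "\<dots> = (\<Sum>i\<in>{1..r}. 2 * real (r - i) * eps i k)"
    by (subst sum.Sigma[symmetric]) (auto intro!: sum.cong)
  finally have "(\<Sum>\<alpha>\<in>pos_roots r. \<alpha>) k = (\<Sum>i\<in>{1..r}. 2 * real (r + 1 - i) * eps i k)"
    by (simp add: algebra_simps of_nat_diff flip: sum.distrib)
  also have "\<dots> = (\<Sum>i\<in>{1..r}. if i = k then 2 * real (r + 1 - k) else 0)"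
    by (rule sum.cong) (auto simp: eps_def)
  finally show ?thesis
    by (simp add: weyl_rho_def vscale_def)
qed

lemma sum_simple_roots:
  assumes "r \<ge> 1"
  shows "(\<Sum>i=1..r. simple_root r i) = eps 1 + eps r"
proof -
  obtain n where r: "r = Suc n" using assms by (cases r) auto
  have telescope: "(\<Sum>i=1..m. eps i - eps (i + 1)) = eps 1 - eps (Suc m)" for m
    by (induction m) auto
  have "(\<Sum>i=1..r. simple_root r i) = (\<Sum>i=1..n. eps i - eps (i + 1)) + vscale 2 (eps r)"
    by (simp add: r simple_root_def)
  also have "\<dots> = eps 1 + eps r"
    unfolding telescope r by (auto simp: vscale_def)
  finally show ?thesis .
qed

section \<open>Positivity of the partition function\<close>
lemma simple_root_in_pos_roots: "i \<in> {1..r} \<Longrightarrow> simple_root r i \<in> pos_roots r"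
  unfolding simple_root_def pos_roots_def by force

lemma prefix_sum_eps: "(\<Sum>i=1..k. eps j i) = (if 1 \<le> j \<and> j \<le> k then 1 else 0)"
  by (simp add: eps_def)

lemma prefix_sum_pos_root:
  assumes "1 \<le> i" "i < j"
  shows "(\<Sum>l=1..k. (eps i - eps j) l) = (if i \<le> k \<and> k < j then 1 else 0)"
    and "(\<Sum>l=1..k. (eps i + eps j) l) = (if i \<le> k then 1 else 0) + (if j \<le> k then 1 else 0)"
    and "(\<Sum>l=1..k. vscale 2 (eps i) l) = (if i \<le> k then 2 else 0)"
  using assms prefix_sum_eps[of i k] prefix_sum_eps[of j k]
  by (simp_all add: vscale_def sum.distrib sum_subtractf del: One_nat_def flip: sum_distrib_left)

lemma prefix_sum_pos_root_nonneg:
  assumes "\<alpha> \<in> pos_roots r"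
  shows "0 \<le> (\<Sum>i=1..k. \<alpha> i)"
proof -
  from assms obtain i j where ij: "1 \<le> i" "i < j"
    and \<alpha>: "\<alpha> = eps i - eps j \<or> \<alpha> = eps i + eps j \<or> \<alpha> = vscale 2 (eps i)"
    unfolding pos_roots_def by (auto intro: lessI)
  show ?thesis
    using \<alpha> by (elim disjE) (simp_all only: prefix_sum_pos_root[OF ij], simp_all)
qed

text \<open>
  This bounds the multiplicity of a root in any partition of \<open>\<xi>\<close> by a prefix sum of \<open>\<xi>\<close>, which
  makes the set of partitions finite. Finiteness has to be proved because the cardinality of an
  infinite set would be \<open>0\<close>.
\<close>
lemma pos_root_has_positive_prefix_sum:
  assumes "\<alpha> \<in> pos_roots r"
  shows "\<exists>k\<in>{1..r}. 1 \<le> (\<Sum>i=1..k. \<alpha> i)"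
proof -
  from assms obtain i j where ij: "1 \<le> i" "i < j" and r: "i \<le> r"
    and \<alpha>: "\<alpha> = eps i - eps j \<or> \<alpha> = eps i + eps j \<or> \<alpha> = vscale 2 (eps i)"
    unfolding pos_roots_def by (auto intro: lessI less_imp_le less_le_trans)
  have "1 \<le> (\<Sum>l=1..i. \<alpha> l)"
    using \<alpha> ij by (elim disjE) (simp_all only: prefix_sum_pos_root[OF ij], simp_all)
  then show ?thesis using ij r by auto
qed

lemma prefix_sum_combination:
  "(\<Sum>i=1..k. (\<Sum>\<alpha>\<in>A. vscale (c \<alpha>) \<alpha>) i) = (\<Sum>\<alpha>\<in>A. c \<alpha> * (\<Sum>i=1..k. \<alpha> i))"
  unfolding sum_fun_apply vscale_def
  by (subst sum.swap) (simp add: sum_distrib_left)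

lemma finite_kostant_partitions:
  "finite {m \<in> pos_roots r \<rightarrow>\<^sub>E (UNIV :: nat set).
             (\<Sum>\<alpha>\<in>pos_roots r. vscale (real (m \<alpha>)) \<alpha>) = \<xi>}" (is "finite ?M")
proof -
  define N where "N = nat \<lceil>\<Sum>k=1..r. \<bar>\<Sum>i=1..k. \<xi> i\<bar>\<rceil>"
  have "m \<alpha> \<le> N" if m: "m \<in> ?M" and \<alpha>: "\<alpha> \<in> pos_roots r" for m \<alpha>
  proof -
    obtain k where k: "k \<in> {1..r}" "1 \<le> (\<Sum>i=1..k. \<alpha> i)"
      using pos_root_has_positive_prefix_sum[OF \<alpha>] by blast
    have combination: "(\<Sum>\<alpha>\<in>pos_roots r. vscale (real (m \<alpha>)) \<alpha>) = \<xi>"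
      using m by simp
    have "real (m \<alpha>) \<le> real (m \<alpha>) * (\<Sum>i=1..k. \<alpha> i)"
      using k(2) by (simp add: mult_le_cancel_left1)
    also have "\<dots> \<le> (\<Sum>\<beta>\<in>pos_roots r. real (m \<beta>) * (\<Sum>i=1..k. \<beta> i))"
      by (rule member_le_sum[OF \<alpha>])
        (auto simp: finite_pos_roots simp del: One_nat_def
          intro!: mult_nonneg_nonneg prefix_sum_pos_root_nonneg)
    also have "\<dots> = (\<Sum>i=1..k. \<xi> i)"
      unfolding combination[symmetric] by (rule prefix_sum_combination[symmetric])
    also have "\<dots> \<le> \<bar>\<Sum>i=1..k. \<xi> i\<bar>" by simp
    also have "\<dots> \<le> (\<Sum>k=1..r. \<bar>\<Sum>i=1..k. \<xi> i\<bar>)"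
      by (rule member_le_sum[OF k(1)]) auto
    finally show ?thesis unfolding N_def by linarith
  qed
  then have "?M \<subseteq> pos_roots r \<rightarrow>\<^sub>E {..N}"
    by (auto simp: PiE_iff extensional_def)
  then show ?thesis
    by (rule finite_subset) (simp add: finite_PiE finite_pos_roots)
qed

lemma inj_on_simple_root: "inj_on (simple_root r) {1..r}"
proof (rule inj_onI)
  fix i j assume ij: "i \<in> {1..r}" "j \<in> {1..r}" and eq: "simple_root r i = simple_root r j"
  show "i = j"
    using fun_cong[OF eq, of i] fun_cong[OF eq, of j] ij
    by (auto simp: simple_root_def eps_def vscale_def split: if_splits)
qed

text \<open>
  The prefix sums up to \<open>k\<close> vanish on every simple root except the \<open>k\<close>-th, so they read off the
  coefficients. The last simple root is long, with prefix sum \<open>2\<close>, hence the factor \<open>2\<close> at \<open>r\<close>.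
\<close>
lemma simple_root_expansion:
  assumes \<xi>: "\<xi> \<in> euclid r"
    and c: "\<And>k. k \<in> {1..<r} \<Longrightarrow> c k = (\<Sum>i=1..k. \<xi> i)" "2 * c r = (\<Sum>i=1..r. \<xi> i)"
  shows "(\<Sum>i=1..r. vscale (c i) (simple_root r i)) = \<xi>"
proof
  fix l
  define P where "P k = (\<Sum>i=1..k. \<xi> i)" for k
  show "(\<Sum>i=1..r. vscale (c i) (simple_root r i)) l = \<xi> l"
  proof (cases "l \<in> {1..r}")
    case False
    then show ?thesis using \<xi>
      by (auto simp: euclid_def sum_fun_apply vscale_def simple_root_def eps_def intro!: sum.neutral)
  next
    case True
    have "(\<Sum>i=1..r. vscale (c i) (simple_root r i)) l
        = (\<Sum>i=1..r. (if i = l then P l else 0) - (if Suc i = l then P i else 0))"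
      unfolding sum_fun_apply
    proof (rule sum.cong)
      fix i assume "i \<in> {1..r}"
      then show "vscale (c i) (simple_root r i) l
          = (if i = l then P l else 0) - (if Suc i = l then P i else 0)"
        using c(1)[of i] c(2) True
        by (cases "i = r") (auto simp: vscale_def simple_root_def eps_def P_def)
    qed simp
    also have "\<dots> = P l - (\<Sum>i=1..r. if Suc i = l then P i else 0)"
      using True by (simp add: sum_subtractf)
    also have "(\<Sum>i=1..r. if Suc i = l then P i else 0)
        = (\<Sum>i=1..r. if i = l - 1 then P (l - 1) else 0)"
      using True by (intro sum.cong) auto
    also have "\<dots> = P (l - 1)"
      using True by (auto simp: P_def)
    also have "P l - P (l - 1) = \<xi> l"
      using True by (cases l) (auto simp: P_def)
    finally show ?thesis .
  qed
qed

lemma kostant_partition_pos_imp_prefix_sum_nonneg: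
  assumes "0 < kostant_partition r \<xi>"
  shows "0 \<le> (\<Sum>i=1..k. \<xi> i)"
proof -
  from assms obtain m :: "(nat \<Rightarrow> real) \<Rightarrow> nat"
    where m: "(\<Sum>\<alpha>\<in>pos_roots r. vscale (real (m \<alpha>)) \<alpha>) = \<xi>"
    unfolding kostant_partition_def card_gt_0_iff by blast
  have "(\<Sum>i=1..k. \<xi> i) = (\<Sum>\<alpha>\<in>pos_roots r. real (m \<alpha>) * (\<Sum>i=1..k. \<alpha> i))"
    unfolding m[symmetric] by (rule prefix_sum_combination)
  also have "\<dots> \<ge> 0"
    by (intro sum_nonneg mult_nonneg_nonneg prefix_sum_pos_root_nonneg) auto
  finally show ?thesis .
qed

lemma kostant_partition_posI:
  assumes \<xi>: "\<xi> \<in> euclid r" and integral: "\<And>i. \<xi> i \<in> \<int>"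
    and nonneg: "\<And>k. k \<le> r \<Longrightarrow> 0 \<le> (\<Sum>i=1..k. \<xi> i)"
    and total: "(\<Sum>i=1..r. \<xi> i) = 2 * real t"
  shows "0 < kostant_partition r \<xi>"
proof -
  define c where "c k = (if k = r then t else nat \<lfloor>\<Sum>i=1..k. \<xi> i\<rfloor>)" for k
  define m where "m = (\<lambda>\<alpha>\<in>pos_roots r. if \<alpha> \<in> simple_root r ` {1..r}
    then c (inv_into {1..r} (simple_root r) \<alpha>) else 0)"
  have "real (c k) = (\<Sum>i=1..k. \<xi> i)" if "k < r" for k
  proof -
    have "(\<Sum>i=1..k. \<xi> i) \<in> \<int>" using integral by (intro Ints_sum) auto
    then show ?thesis using nonneg[of k] that by (auto simp: c_def elim!: Ints_cases)
  qed
  then have expansion: "(\<Sum>i=1..r. vscale (real (c i)) (simple_root r i)) = \<xi>"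
    using \<xi> total by (intro simple_root_expansion) (auto simp: c_def)
  have "(\<Sum>\<alpha>\<in>pos_roots r. vscale (real (m \<alpha>)) \<alpha>)
      = (\<Sum>\<alpha>\<in>simple_root r ` {1..r}. vscale (real (m \<alpha>)) \<alpha>)"
    by (rule sum.mono_neutral_right)
      (auto simp: finite_pos_roots simple_root_in_pos_roots m_def vscale_def)
  also have "\<dots> = (\<Sum>i=1..r. vscale (real (c i)) (simple_root r i))"
    by (subst sum.reindex[OF inj_on_simple_root])
      (auto intro!: sum.cong simp: m_def simple_root_in_pos_roots
        inv_into_f_f[OF inj_on_simple_root] simp del: One_nat_def)
  finally have "(\<Sum>\<alpha>\<in>pos_roots r. vscale (real (m \<alpha>)) \<alpha>) = \<xi>"
    using expansion by simp
  moreover have "m \<in> pos_roots r \<rightarrow>\<^sub>E UNIV" by (auto simp: m_def)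
  ultimately show ?thesis
    unfolding kostant_partition_def card_gt_0_iff using finite_kostant_partitions by blast
qed


section \<open>The Weyl group as signed permutations\<close>
definition signed_perm ::
    "nat \<Rightarrow> (nat \<Rightarrow> nat) \<Rightarrow> (nat \<Rightarrow> real) \<Rightarrow> (nat \<Rightarrow> real) \<Rightarrow> (nat \<Rightarrow> real)" where
  "signed_perm r p s = (\<lambda>v\<in>euclid r. \<lambda>i. s i * v (p i))"

lemma signed_perm_in_euclid:
  assumes "p permutes {1..r}" "v \<in> euclid r"
  shows "(\<lambda>i. s i * v (p i)) \<in> euclid r"
  using assms by (auto simp: euclid_def permutes_def)

lemma compose_signed_perm:
  assumes "q permutes {1..r}"
  shows "compose (euclid r) (signed_perm r p s) (signed_perm r q t)
       = signed_perm r (q \<circ> p) (\<lambda>i. s i * t (p i))"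
  using signed_perm_in_euclid[OF assms]
  by (auto simp: signed_perm_def compose_def restrict_def fun_eq_iff)

lemma signed_perm_in_Bij:
  assumes p: "p permutes {1..r}" and s: "\<And>i. \<bar>s i\<bar> = 1"
  shows "signed_perm r p s \<in> Bij (euclid r)"
proof -
  have square: "s i * s i = 1" for i
    using s[of i] by (metis abs_mult_self_eq mult_1)
  let ?t = "\<lambda>i. s (inv_into UNIV p i)"
  have "bij_betw (signed_perm r p s) (euclid r) (euclid r)"
  proof (rule bij_betw_byWitness[where f' = "signed_perm r (inv_into UNIV p) ?t"])
    show "\<forall>v\<in>euclid r. signed_perm r (inv_into UNIV p) ?t (signed_perm r p s v) = v"
      using signed_perm_in_euclid[OF p]
      by (auto simp: signed_perm_def permutes_inverses[OF p] square simp flip: mult.assoc)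
    show "\<forall>v\<in>euclid r. signed_perm r p s (signed_perm r (inv_into UNIV p) ?t v) = v"
      using signed_perm_in_euclid[OF permutes_inv[OF p], where s = ?t]
      by (auto simp: signed_perm_def permutes_inverses[OF p] square simp flip: mult.assoc)
  qed (use signed_perm_in_euclid[OF p] signed_perm_in_euclid[OF permutes_inv[OF p]] in
      \<open>auto simp: signed_perm_def\<close>)
  then show ?thesis by (simp add: Bij_def signed_perm_def)
qed

lemma ip_eps: "i \<in> {1..r} \<Longrightarrow> ip r v (eps i) = v i"
  by (simp add: ip_def eps_def if_distrib[of "(*) _"] cong: if_cong)

lemma ip_diff_right: "ip r v (a - b) = ip r v a - ip r v b"
  by (simp add: ip_def right_diff_distrib sum_subtractf)

lemma ip_scale_right: "ip r v (vscale c a) = c * ip r v a"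
  by (simp add: ip_def vscale_def sum_distrib_left mult.left_commute)

lemma reflection_short_simple_root:
  assumes "1 \<le> i" "i < r"
  shows "reflection r (simple_root r i) v = (\<lambda>j. v (Transposition.transpose i (i + 1) j))"
proof -
  have "ip r v (eps i - eps (i + 1)) = v i - v (i + 1)" for v
    using assms by (simp add: ip_diff_right ip_eps)
  then show ?thesis
    using assms unfolding reflection_def simple_root_def
    by (auto simp: fun_eq_iff vscale_def eps_def Transposition.transpose_def diff_divide_distrib)
qed

lemma reflection_long_simple_root:
  assumes "1 \<le> r"
  shows "reflection r (simple_root r r) v = (\<lambda>j. (if j = r then - 1 else 1) * v j)"
proof -
  have "ip r v (vscale 2 (eps r)) = 2 * v r" for v
    using assms by (simp add: ip_scale_right ip_eps)
  then show ?thesis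
    unfolding reflection_def simple_root_def by (auto simp: fun_eq_iff vscale_def eps_def)
qed

lemma restrict_reflection_eq_signed_perm:
  assumes "i \<in> {1..r}"
  shows "restrict (reflection r (simple_root r i)) (euclid r) =
    (if i < r then signed_perm r (Transposition.transpose i (i + 1)) (\<lambda>_. 1)
     else signed_perm r id (\<lambda>j. if j = r then - 1 else 1))"
  using assms reflection_short_simple_root[of i r] reflection_long_simple_root[of r]
  by (auto simp: signed_perm_def intro!: restrict_ext)

lemma mult_BijGroup: "f \<in> Bij S \<Longrightarrow> g \<in> Bij S \<Longrightarrow> f \<otimes>\<^bsub>BijGroup S\<^esub> g = compose S f g"
  by (simp add: BijGroup_def)

lemma one_BijGroup_euclid: "\<one>\<^bsub>BijGroup (euclid r)\<^esub> = signed_perm r id (\<lambda>_. 1)"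
  by (simp add: BijGroup_def signed_perm_def)

lemma simple_reflection_involutive_signed_perm:
  assumes "i \<in> {1..r}"
  obtains p s where "p permutes {1..r}" "\<forall>i. \<bar>s i\<bar> = 1" "p \<circ> p = id" "\<forall>i. s i * s (p i) = 1"
    "restrict (reflection r (simple_root r i)) (euclid r) = signed_perm r p s"
proof (cases "i < r")
  case True
  show ?thesis
  proof (rule that)
    show "Transposition.transpose i (i + 1) permutes {1..r}"
      using True assms by (intro permutes_swap_id) auto
    show "restrict (reflection r (simple_root r i)) (euclid r)
        = signed_perm r (Transposition.transpose i (i + 1)) (\<lambda>_. 1)"
      using True assms by (simp add: restrict_reflection_eq_signed_perm)
  qed auto
next
  case False
  show ?thesis
  proof (rule that)
    show "id permutes {1..r}" by (rule permutes_id)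
    show "restrict (reflection r (simple_root r i)) (euclid r)
        = signed_perm r id (\<lambda>j. if j = r then - 1 else 1)"
      using False assms by (simp add: restrict_reflection_eq_signed_perm)
  qed auto
qed

lemma inv_simple_reflection:
  assumes "i \<in> {1..r}"
  defines "h \<equiv> restrict (reflection r (simple_root r i)) (euclid r)"
  shows "inv\<^bsub>BijGroup (euclid r)\<^esub> h = h"
proof -
  obtain p s where p: "p permutes {1..r}" and s: "\<forall>i. \<bar>s i\<bar> = 1"
    and involutive: "p \<circ> p = id" "\<forall>i. s i * s (p i) = 1" and h: "h = signed_perm r p s"
    unfolding h_def by (rule simple_reflection_involutive_signed_perm[OF assms(1)])
  have mem: "h \<in> Bij (euclid r)"
    unfolding h using p s by (intro signed_perm_in_Bij) auto
  have "h \<otimes>\<^bsub>BijGroup (euclid r)\<^esub> h = \<one>\<^bsub>BijGroup (euclid r)\<^esub>"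
    using mem involutive
    by (simp add: mult_BijGroup one_BijGroup_euclid) (simp add: h compose_signed_perm[OF p])
  moreover have "h \<in> carrier (BijGroup (euclid r))"
    using mem by (simp add: BijGroup_def)
  ultimately show ?thesis
    by (simp add: group.inv_equality[OF group_BijGroup])
qed

text \<open>
  Generated subgroups also contain the inverses of the generators; these add nothing new because
  reflections are involutions.
\<close>
lemma weyl_group_signed_perm:
  assumes "\<sigma> \<in> weyl_group r"
  shows "\<exists>p s. p permutes {1..r} \<and> (\<forall>i. \<bar>s i\<bar> = 1) \<and> \<sigma> = signed_perm r p s"
  using assms unfolding weyl_group_def
proof (induction rule: generate.induct)
  case one
  show ?case
    unfolding one_BijGroup_euclid
    by (intro exI[of _ id] exI[of _ "\<lambda>_. 1"]) (simp add: permutes_id del: id_apply)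
next
  case (incl h)
  then show ?case
    by (elim imageE) (metis simple_reflection_involutive_signed_perm)
next
  case (inv h)
  then show ?case
    by (elim imageE) (metis inv_simple_reflection simple_reflection_involutive_signed_perm)
next
  case (eng h1 h2)
  then obtain p s q t where h1: "p permutes {1..r}" "\<forall>i. \<bar>s i\<bar> = 1" "h1 = signed_perm r p s"
    and h2: "q permutes {1..r}" "\<forall>i. \<bar>t i\<bar> = 1" "h2 = signed_perm r q t"
    by blast
  have "h1 \<otimes>\<^bsub>BijGroup (euclid r)\<^esub> h2 = signed_perm r (q \<circ> p) (\<lambda>i. s i * t (p i))"
    using h1 h2 by (simp add: mult_BijGroup signed_perm_in_Bij compose_signed_perm)
  moreover have "q \<circ> p permutes {1..r}" using h1 h2 by (intro permutes_compose)
  moreover have "\<forall>i. \<bar>s i * t (p i)\<bar> = 1" using h1 h2 by (simp add: abs_mult)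
  ultimately show ?case
    by (intro exI[of _ "q \<circ> p"] exI[of _ "\<lambda>i. s i * t (p i)"]) blast
qed

lemma comp_in_weyl_group:
  assumes "p permutes {1..r}" "q permutes {1..r}"
    and "signed_perm r p (\<lambda>_. 1) \<in> weyl_group r" "signed_perm r q (\<lambda>_. 1) \<in> weyl_group r"
  shows "signed_perm r (q \<circ> p) (\<lambda>_. 1) \<in> weyl_group r"
proof -
  have "signed_perm r p (\<lambda>_. 1) \<otimes>\<^bsub>BijGroup (euclid r)\<^esub> signed_perm r q (\<lambda>_. 1) \<in> weyl_group r"
    using assms(3,4) unfolding weyl_group_def by (rule generate.eng)
  then show ?thesis
    using assms(1,2) by (simp add: mult_BijGroup signed_perm_in_Bij compose_signed_perm)
qed

text \<open>
  The short simple reflections are the adjacent transpositions; conjugating with them moves one of the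
  two exchanged points further away.
\<close>
lemma transposition_in_weyl_group:
  assumes "1 \<le> i" "i + Suc d \<le> r"
  shows "signed_perm r (Transposition.transpose i (i + Suc d)) (\<lambda>_. 1) \<in> weyl_group r"
  using assms(2)
proof (induction d)
  case 0
  have "restrict (reflection r (simple_root r i)) (euclid r) \<in> weyl_group r"
    unfolding weyl_group_def using 0 assms(1) by (intro generate.incl imageI) auto
  then show ?case
    using 0 assms(1) by (simp add: restrict_reflection_eq_signed_perm)
next
  case (Suc d)
  let ?k = "i + Suc d"
  let ?step = "Transposition.transpose ?k (?k + 1)"
  have ik: "Transposition.transpose i ?k permutes {1..r}" and step: "?step permutes {1..r}"
    using Suc.prems assms(1) by (auto intro!: permutes_swap_id)
  have "restrict (reflection r (simple_root r ?k)) (euclid r) \<in> weyl_group r"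
    unfolding weyl_group_def using Suc.prems assms(1) by (intro generate.incl imageI) auto
  then have step_mem: "signed_perm r ?step (\<lambda>_. 1) \<in> weyl_group r"
    using Suc.prems assms(1) by (subst (asm) restrict_reflection_eq_signed_perm) auto
  have "signed_perm r (?step \<circ> Transposition.transpose i ?k \<circ> ?step) (\<lambda>_. 1) \<in> weyl_group r"
    using Suc step_mem ik step by (intro comp_in_weyl_group permutes_compose) auto
  moreover have "?step \<circ> Transposition.transpose i ?k \<circ> ?step = Transposition.transpose i (i + Suc (Suc d))"
    by (auto simp: fun_eq_iff Transposition.transpose_def)
  ultimately show ?case by simp
qed

lemma permutation_in_weyl_group:
  assumes "p permutes {1..r}"
  shows "signed_perm r p (\<lambda>_. 1) \<in> weyl_group r"
  using assms finite_atLeastAtMost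
proof (induction rule: permutes_induct)
  case id
  have "\<one>\<^bsub>BijGroup (euclid r)\<^esub> \<in> weyl_group r"
    unfolding weyl_group_def by (rule generate.one)
  then show ?case by (simp only: one_BijGroup_euclid)
next
  case (swap a b p)
  have ordered: "signed_perm r (Transposition.transpose a b) (\<lambda>_. 1) \<in> weyl_group r"
    if "a \<in> {1..r}" "b \<in> {1..r}" "a < b" for a b
    using that transposition_in_weyl_group[of a "b - a - 1" r] by auto
  have "signed_perm r (Transposition.transpose a b) (\<lambda>_. 1) \<in> weyl_group r"
    using swap(1-3) ordered[of a b] ordered[of b a] by (metis linorder_neqE transpose_commute)
  then show ?case
    using swap by (intro comp_in_weyl_group permutes_swap_id) auto
qed

section \<open>The alternation set as a set of arrangements\<close>

text \<open>
  The coordinate \<open>j\<close> gets the label \<open>r + 1 - j\<close>, which is the value of \<open>\<rho>\<close> there. A label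
  maps to the corresponding coordinate of \<open>\<lambda> + \<rho>\<close>.
\<close>
definition shifted_value :: "nat \<Rightarrow> nat \<Rightarrow> int" where
  "shifted_value r x = (if x = r then int r + 1 else max (int x) 2)"

definition arrangements :: "nat \<Rightarrow> nat list set" where
  "arrangements r = {xs \<in> permutations_of_set {1..r}. slack_ok (shifted_value r) 0 (int r) xs}"

text \<open>
  The first weight must be at least \<open>r\<close>, and only the label \<open>r\<close> has such a weight. This uses
  \<open>r \<ge> 3\<close>: for \<open>r = 2\<close> the label \<open>1\<close> would qualify too.
\<close>
lemma arrangements_eq_Cons_tail:
  assumes "r \<ge> 3"
  shows "arrangements r = Cons r ` tail_arrangements (r - 1)"
proof -
  have remove_top: "{1..r} - {r} = {1..r - 1}" using assms by auto
  have "r # xs \<in> arrangements r \<longleftrightarrow> xs \<in> tail_arrangements (r - 1)" for xs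
  proof -
    have "slack_ok (shifted_value r) 1 (int r - 1) xs
        \<longleftrightarrow> slack_ok (\<lambda>x. max (int x) 2) 1 (int (r - 1)) xs"
      if "xs \<in> permutations_of_set {1..r - 1}"
      using that assms
      by (subst slack_ok_cong[of _ "shifted_value r" "\<lambda>x. max (int x) 2"])
        (auto simp: shifted_value_def permutations_of_set_def of_nat_diff)
    then show ?thesis
      using assms unfolding arrangements_def tail_arrangements_def mem_Collect_eq
        permutations_of_set_Cons_iff remove_top slack_ok.simps by (auto simp: shifted_value_def)
  qed
  moreover have "\<exists>xs. zs = r # xs" if zs: "zs \<in> arrangements r" for zs
  proof -
    have "zs \<noteq> []"
      using zs assms by (auto simp: arrangements_def permutations_of_set_def)
    then obtain x xs where x: "zs = x # xs" by (cases zs) auto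
    have "x \<in> {1..r}" and ok: "slack_ok (shifted_value r) (shifted_value r x - int r) (int r - 1) xs"
      using zs by (simp_all add: arrangements_def x permutations_of_set_Cons_iff)
    then have "x = r"
      using slack_ok_nonneg[OF ok] assms by (auto simp: shifted_value_def max_def split: if_splits)
    then show ?thesis using x by blast
  qed
  ultimately show ?thesis by blast
qed

text \<open>
  The labels of the coordinates of \<open>\<lambda> + \<rho>\<close>, in the order in which the permutation \<open>p\<close> places
  them.
\<close>
definition label_word :: "nat \<Rightarrow> (nat \<Rightarrow> nat) \<Rightarrow> nat list" where
  "label_word r p = map (\<lambda>i. r + 1 - p i) [1..<Suc r]"

lemma length_label_word: "length (label_word r p) = r"
  by (simp add: label_word_def)

lemma nth_label_word: "i < r \<Longrightarrow> label_word r p ! i = r + 1 - p (Suc i)"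
  by (simp add: label_word_def nth_map_upt del: upt_Suc)

text \<open>
  A permutation can be recovered from its word, and there are as many permutations as words, so the
  injection is onto.
\<close>
lemma bij_betw_label_word:
  "bij_betw (label_word r) {p. p permutes {1..r}} (permutations_of_set {1..r})"
proof -
  have inj: "inj_on (label_word r) {p. p permutes {1..r}}"
  proof (rule inj_onI, unfold mem_Collect_eq)
    fix p q assume p: "p permutes {1..r}" and q: "q permutes {1..r}"
      and eq: "label_word r p = label_word r q"
    have "p i = q i" if i: "i \<in> {1..r}" for i
    proof -
      have "r + 1 - p i = r + 1 - q i"
        using arg_cong[OF eq, of "\<lambda>xs. xs ! (i - 1)"] i nth_label_word[of "i - 1" r]
        by (cases i) auto
      moreover have "p i \<in> {1..r}" "q i \<in> {1..r}"
        using i permutes_in_image[OF p] permutes_in_image[OF q] by blast+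
      ultimately show ?thesis by auto
    qed
    then show "p = q"
      using p q by (metis ext permutes_not_in)
  qed
  have "label_word r ` {p. p permutes {1..r}} \<subseteq> permutations_of_set {1..r}"
  proof clarify
    fix p assume p: "p permutes {1..r}"
    have "bij_betw (\<lambda>x. r + 1 - x) {1..r} {1..r}"
      by (rule bij_betw_byWitness[where f' = "\<lambda>x. r + 1 - x"]) auto
    with permutes_imp_bij[OF p] have "bij_betw ((\<lambda>x. r + 1 - x) \<circ> p) {1..r} {1..r}"
      by (rule bij_betw_trans)
    moreover have "set [1..<Suc r] = {1..r}" by auto
    ultimately show "label_word r p \<in> permutations_of_set {1..r}"
      by (simp add: label_word_def permutations_of_set_def distinct_map bij_betw_def o_def
          del: upt_Suc)
  qed
  moreover have "card (label_word r ` {p. p permutes {1..r}}) = card (permutations_of_set {1..r})"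
    unfolding card_image[OF inj] by (simp add: card_permutations)
  ultimately have "label_word r ` {p. p permutes {1..r}} = permutations_of_set {1..r}"
    by (intro card_subset_eq) auto
  with inj show ?thesis by (simp add: bij_betw_def)
qed

lemma card_arrangement_permutations:
  "card {p. p permutes {1..r} \<and> label_word r p \<in> arrangements r} = card (arrangements r)"
proof (rule bij_betw_same_card)
  have "label_word r ` {p. p permutes {1..r} \<and> label_word r p \<in> arrangements r} = arrangements r"
  proof -
    have "label_word r ` {p. p permutes {1..r} \<and> label_word r p \<in> arrangements r}
        = label_word r ` {p. p permutes {1..r}} \<inter> arrangements r"
      by blast
    also have "\<dots> = permutations_of_set {1..r} \<inter> arrangements r"
      by (simp only: bij_betw_imp_surj_on[OF bij_betw_label_word])
    also have "\<dots> = arrangements r"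
      unfolding arrangements_def by blast
    finally show ?thesis .
  qed
  then show "bij_betw (label_word r) {p. p permutes {1..r} \<and> label_word r p \<in> arrangements r}
      (arrangements r)"
    by (intro bij_betw_subset[OF bij_betw_label_word]) auto
qed

lemma shifted_weight_apply:
  assumes "r \<ge> 3"
  shows "((\<Sum>i=1..r. simple_root r i) + weyl_rho r) j =
    (if j \<in> {1..r} then real_of_int (shifted_value r (r + 1 - j)) else 0)"
proof -
  have split: "((\<Sum>i=1..r. simple_root r i) + weyl_rho r) j = eps 1 j + eps r j + weyl_rho r j"
    using assms sum_simple_roots[of r] by simp
  consider "j \<notin> {1..r}" | "j = 1" | "j = r" | "j \<in> {1..r}" "j \<noteq> 1" "j \<noteq> r" by blast
  then show ?thesis
    unfolding split weyl_rho_apply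
    using assms by cases (auto simp: shifted_value_def eps_def)
qed

text \<open>
  The total sum decides about signs: all coordinates of \<open>\<lambda> + \<rho>\<close> are at least \<open>2\<close>, so a
  negative sign lowers the total by at least \<open>4\<close>, which is more than the surplus \<open>2\<close> over
  \<open>\<rho>\<close>. Without signs the total of the difference is the even number \<open>2\<close>, and the prefix sums are
  the slacks of the word.
\<close>
lemma kostant_partition_pos_iff_arrangement:
  assumes r: "r \<ge> 3" and p: "p permutes {1..r}" and s: "\<forall>i. \<bar>s i\<bar> = 1"
  defines "a \<equiv> (\<Sum>i=1..r. simple_root r i) + weyl_rho r"
  shows "0 < kostant_partition r (signed_perm r p s a - (0 + weyl_rho r)) \<longleftrightarrow>
    (\<forall>i\<in>{1..r}. s i = 1) \<and> label_word r p \<in> arrangements r"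
proof -
  define \<xi> where "\<xi> = signed_perm r p s a - (0 + weyl_rho r)"
  have a: "a j = (if j \<in> {1..r} then real_of_int (shifted_value r (r + 1 - j)) else 0)" for j
    unfolding a_def by (rule shifted_weight_apply[OF r])
  have a_mem: "a \<in> euclid r" by (simp add: euclid_def a)
  have \<xi>: "\<xi> l = s l * a (p l) - weyl_rho r l" for l
    using a_mem by (simp add: \<xi>_def signed_perm_def)
  have p_mem: "p l \<in> {1..r} \<longleftrightarrow> l \<in> {1..r}" for l
    by (rule permutes_in_image[OF p])
  have a_ge_2: "2 \<le> a (p l)" if "l \<in> {1..r}" for l
    using that p_mem[of l] r by (auto simp: a shifted_value_def)
  have "(\<Sum>l=1..r. a (p l)) = (\<Sum>l=1..r. a l)"
    using sum.permute[OF p, of a] by (simp add: o_def)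
  also have "\<dots> = (\<Sum>l=1..r. eps 1 l + eps r l) + (\<Sum>l=1..r. weyl_rho r l)"
    using r sum_simple_roots[of r] by (simp add: a_def sum.distrib)
  also have "(\<Sum>l=1..r. eps 1 l + eps r l) = 2"
    using r unfolding sum.distrib prefix_sum_eps by simp
  finally have total: "(\<Sum>l=1..r. a (p l) - weyl_rho r l) = 2"
    by (simp add: sum_subtractf)
  have signs: "\<forall>i\<in>{1..r}. s i = 1" if pos: "0 < kostant_partition r \<xi>"
  proof (rule ccontr)
    assume "\<not> (\<forall>i\<in>{1..r}. s i = 1)"
    then obtain j where j: "j \<in> {1..r}" "s j = - 1" using s by (metis abs_if minus_minus)
    (* The j-th coordinate alone lowers the total below 0; the other signs can only lower it more. *)
    have "(\<Sum>l\<in>{1..r} - {j}. (s l - 1) * a (p l)) \<le> 0"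
    proof (intro sum_nonpos mult_nonpos_nonneg)
      fix l assume "l \<in> {1..r} - {j}"
      then show "0 \<le> a (p l)" using a_ge_2[of l] by simp
      show "s l - 1 \<le> 0" using s by (metis abs_ge_self diff_le_0_iff_le)
    qed
    then have "(\<Sum>l=1..r. (s l - 1) * a (p l)) \<le> - 2 * a (p j)"
      using j by (simp add: sum.remove)
    moreover have "(\<Sum>l=1..r. \<xi> l)
        = (\<Sum>l=1..r. a (p l) - weyl_rho r l) + (\<Sum>l=1..r. (s l - 1) * a (p l))"
      unfolding \<xi> sum.distrib[symmetric] by (rule sum.cong) (auto simp: algebra_simps)
    ultimately have "(\<Sum>l=1..r. \<xi> l) < 0"
      using a_ge_2[OF j(1)] total by linarith
    then show False
      using kostant_partition_pos_imp_prefix_sum_nonneg[OF pos, of r] by linarith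
  qed
  have main: "0 < kostant_partition r \<xi> \<longleftrightarrow> label_word r p \<in> arrangements r"
    if s1: "\<forall>i\<in>{1..r}. s i = 1"
  proof -
    have prefix: "(\<Sum>l=1..k. \<xi> l)
        = real_of_int (0 + (\<Sum>i<k. shifted_value r (label_word r p ! i) - (int r - int i)))"
      if "k \<le> r" for k
    proof -
      have "(\<Sum>l=1..k. \<xi> l) = (\<Sum>i<k. \<xi> (Suc i))"
        by (rule sum.reindex_bij_witness[of _ Suc "\<lambda>i. i - 1"]) auto
      also have "\<dots> = (\<Sum>i<k. real_of_int
          (shifted_value r (label_word r p ! i) - (int r - int i)))"
      proof (rule sum.cong)
        fix i assume "i \<in> {..<k}"
        then have i: "Suc i \<in> {1..r}" "i < r" using that by auto
        then have "p (Suc i) \<in> {1..r}" using p_mem by blast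
        then show "\<xi> (Suc i)
            = real_of_int (shifted_value r (label_word r p ! i) - (int r - int i))"
          using i s1 by (simp add: \<xi> a weyl_rho_apply nth_label_word of_nat_diff)
      qed simp
      finally show ?thesis by simp
    qed
    have "label_word r p \<in> arrangements r \<longleftrightarrow>
        slack_ok (shifted_value r) 0 (int r) (label_word r p)"
      using bij_betwE[OF bij_betw_label_word, of r] p by (auto simp: arrangements_def)
    also have "\<dots> \<longleftrightarrow> (\<forall>k\<le>r. 0 \<le> (\<Sum>l=1..k. \<xi> l))"
      unfolding slack_ok_iff_prefix_sums length_label_word
      using prefix by (metis of_int_0_le_iff)
    also have "\<dots> \<longleftrightarrow> 0 < kostant_partition r \<xi>"
    proof
      assume nonneg: "\<forall>k\<le>r. 0 \<le> (\<Sum>l=1..k. \<xi> l)"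
      have outside: "\<xi> l = 0" if "l \<notin> {1..r}" for l
        using that p_mem[of l] unfolding \<xi> a weyl_rho_apply by auto
      show "0 < kostant_partition r \<xi>"
      proof (rule kostant_partition_posI)
        show "\<xi> \<in> euclid r" using outside by (simp add: euclid_def)
        show "\<xi> l \<in> \<int>" for l
          using s1 outside[of l] by (cases "l \<in> {1..r}") (auto simp: \<xi> a weyl_rho_apply)
        show "(\<Sum>i=1..r. \<xi> i) = 2 * real 1"
          using total s1 by (simp add: \<xi>)
      qed (use nonneg in blast)
    qed (use kostant_partition_pos_imp_prefix_sum_nonneg in blast)
    finally show ?thesis by blast
  qed
  show ?thesis
    unfolding \<xi>_def[symmetric] using signs main by blast
qed

lemma signed_perm_cong:
  assumes "\<And>i. i \<in> {1..r} \<Longrightarrow> s i = t i" "p permutes {1..r}"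
  shows "signed_perm r p s = signed_perm r p t"
proof -
  have "s i * v (p i) = t i * v (p i)" if "v \<in> euclid r" for v i
    using assms that permutes_not_in[OF assms(2), of i] by (cases "i \<in> {1..r}") (auto simp: euclid_def)
  then show ?thesis unfolding signed_perm_def by (intro restrict_ext) auto
qed

lemma inj_on_signed_perm: "inj_on (\<lambda>p. signed_perm r p (\<lambda>_. 1)) {p. p permutes {1..r}}"
proof (rule inj_onI, unfold mem_Collect_eq)
  fix p q assume p: "p permutes {1..r}" and q: "q permutes {1..r}"
    and eq: "signed_perm r p (\<lambda>_. 1) = signed_perm r q (\<lambda>_. 1)"
  (* A vector with pairwise different coordinates on {1..r} distinguishes all permutations. *)
  let ?v = "\<lambda>i. if i \<in> {1..r} then real i else 0"
  have "?v \<in> euclid r" by (simp add: euclid_def)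
  then have "?v (p i) = ?v (q i)" for i
    using fun_cong[OF fun_cong[OF eq], of ?v i] by (simp add: signed_perm_def del: One_nat_def)
  then have "p i = q i" if "i \<in> {1..r}" for i
    using that permutes_in_image[OF p] permutes_in_image[OF q] by (metis of_nat_eq_iff)
  then show "p = q"
    using p q by (metis ext permutes_not_in)
qed

lemma alternation_set_eq:
  assumes r: "r \<ge> 3"
  shows "alternation_set r (\<Sum>i=1..r. simple_root r i) 0 =
    (\<lambda>p. signed_perm r p (\<lambda>_. 1)) ` {p. p permutes {1..r} \<and> label_word r p \<in> arrangements r}"
    (is "?A = ?B")
proof (intro equalityI subsetI)
  fix \<sigma> assume \<sigma>: "\<sigma> \<in> ?A"
  then obtain p s where ps: "p permutes {1..r}" "\<forall>i. \<bar>s i\<bar> = 1" "\<sigma> = signed_perm r p s"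
    using weyl_group_signed_perm unfolding alternation_set_def by blast
  then have "\<forall>i\<in>{1..r}. s i = 1" "label_word r p \<in> arrangements r"
    using \<sigma> kostant_partition_pos_iff_arrangement[OF r ps(1,2)]
    unfolding alternation_set_def by blast+
  then show "\<sigma> \<in> ?B"
    using ps signed_perm_cong[of r s "\<lambda>_. 1" p] by blast
next
  fix \<sigma> assume "\<sigma> \<in> ?B"
  then obtain p where p: "p permutes {1..r}" "label_word r p \<in> arrangements r"
    and \<sigma>: "\<sigma> = signed_perm r p (\<lambda>_. 1)" by blast
  then show "\<sigma> \<in> ?A"
    using kostant_partition_pos_iff_arrangement[OF r p(1), of "\<lambda>_. 1"] permutation_in_weyl_group[OF p(1)]
    unfolding alternation_set_def by simp
qed

theorem corollary3p1:
  fixes r :: nat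
  assumes "r \<ge> 3"
  shows "card (alternation_set r (\<Sum>i=1..r. simple_root r i) 0) = 2 * lucas (r - 2)"
proof -
  have "card (alternation_set r (\<Sum>i=1..r. simple_root r i) 0)
      = card {p. p permutes {1..r} \<and> label_word r p \<in> arrangements r}"
    unfolding alternation_set_eq[OF assms]
    by (rule card_image) (rule inj_on_subset[OF inj_on_signed_perm], blast)
  also have "\<dots> = card (tail_arrangements (r - 1))"
    unfolding card_arrangement_permutations unfolding arrangements_eq_Cons_tail[OF assms]
    by (rule card_image) (simp add: inj_on_def)
  also have "\<dots> = 2 * lucas (r - 2)"
    using assms card_tail_arrangements[of "r - 3"] by (simp add: eval_nat_numeral Suc_diff_Suc)
  finally show ?thesis .
qed

end
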